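(* Let $(X,\mathcal T)$ be a topological space, and let $\mathcal T_l$ be the topology on $X$ having the family of all $\mathcal T$-locally closed subsets of $X$ as a base. Then $(X,\mathcal T)$ is a $T_D$-space if and only if $(X,\mathcal T_l)$ is discrete.
   Context: No separation axioms are assumed. A subset $A$ of a topological space $X$ is locally closed if for every $x\in A$ there is an open set $U\subseteq X$ such that $x\in U$ and $A\cap U$ is closed in $U$ (equivalently, $A$ is the intersection of an open set and a closed set). Finite intersections of locally closed sets are locally closed, so the $\mathcal T$-locally closed sets form a base for a topology $\mathcal T_l\supseteq\mathcal T$ on $X$. A space is a $T_D$-space if every singleton is locally closed. *)

theory Defs
  imports "HOL-Analysis.Abstract_Topology"
begin

definition locally_closedin :: "'a topology \<Rightarrow> 'a set \<Rightarrow> bool" where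
  "locally_closedin X A \<longleftrightarrow> A \<subseteq> topspace X \<and>
     (\<forall>x\<in>A. \<exists>U. openin X U \<and> x \<in> U \<and> closedin (subtopology X U) (A \<inter> U))"

definition T_D_space :: "'a topology \<Rightarrow> bool" where
  "T_D_space X \<longleftrightarrow> (\<forall>x\<in>topspace X. locally_closedin X {x})"

definition locally_closed_topology :: "'a topology \<Rightarrow> 'a topology" where
  "locally_closed_topology X = topology (arbitrary union_of locally_closedin X)"

lemma locally_closedin_Int:
  assumes A: "locally_closedin X A" and B: "locally_closedin X B"
  shows "locally_closedin X (A \<inter> B)"
  unfolding locally_closedin_def
proof (intro conjI ballI)
  show "A \<inter> B \<subseteq> topspace X"
    using A by (auto simp: locally_closedin_def)
next
  fix x assume x: "x \<in> A \<inter> B"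
  obtain U where U: "openin X U" "x \<in> U" "closedin (subtopology X U) (A \<inter> U)"
    using A x by (auto simp: locally_closedin_def)
  obtain V where V: "openin X V" "x \<in> V" "closedin (subtopology X V) (B \<inter> V)"
    using B x by (auto simp: locally_closedin_def)
  obtain C where C: "closedin X C" "A \<inter> U = C \<inter> U"
    using U(3) by (auto simp: closedin_subtopology)
  obtain D where D: "closedin X D" "B \<inter> V = D \<inter> V"
    using V(3) by (auto simp: closedin_subtopology)
  have "A \<inter> B \<inter> (U \<inter> V) = (C \<inter> D) \<inter> (U \<inter> V)"
    using C(2) D(2) by blast
  then have "closedin (subtopology X (U \<inter> V)) (A \<inter> B \<inter> (U \<inter> V))"
    using C(1) D(1) closedin_Int closedin_subtopology by blast
  then show "\<exists>W. openin X W \<and> x \<in> W \<and> closedin (subtopology X W) (A \<inter> B \<inter> W)"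
    using U V by (intro exI[of _ "U \<inter> V"]) auto
qed

text \<open>The constant \<^const>\<open>topology\<close> is unspecified on predicates that are not
  topologies; the following lemma rules this out here.\<close>

lemma openin_locally_closed_topology:
  "openin (locally_closed_topology X) = arbitrary union_of locally_closedin X"
  unfolding locally_closed_topology_def
  by (rule topology_inverse') (rule istopology_base, rule locally_closedin_Int)

lemma openin_imp_locally_closedin:
  assumes "openin X U"
  shows "locally_closedin X U"
  unfolding locally_closedin_def
proof (intro conjI ballI)
  show "U \<subseteq> topspace X"
    using assms by (rule openin_subset)
next
  fix x assume "x \<in> U"
  moreover have "closedin (subtopology X U) (U \<inter> U)"
    using closedin_topspace[of "subtopology X U"] openin_subset[OF assms]
    by (simp add: Int_absorb1)
  ultimately show "\<exists>V. openin X V \<and> x \<in> V \<and> closedin (subtopology X V) (U \<inter> V)"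
    using assms by blast
qed

lemma topspace_locally_closed_topology [simp]:
  "topspace (locally_closed_topology X) = topspace X"
proof
  have "S \<subseteq> topspace X" if "openin (locally_closed_topology X) S" for S
    using that unfolding openin_locally_closed_topology union_of_def locally_closedin_def by blast
  then show "topspace (locally_closed_topology X) \<subseteq> topspace X"
    by blast
  have "openin (locally_closed_topology X) (topspace X)"
    unfolding openin_locally_closed_topology
    by (intro arbitrary_union_of_inc openin_imp_locally_closedin openin_topspace)
  then show "topspace X \<subseteq> topspace (locally_closed_topology X)"
    by (rule openin_subset)
qed

end

theory Submission
  imports Defs
begin

text \<open>A nonempty open set contains a nonempty basic open set, and the only nonempty subset of a
  singleton is the singleton itself. Hence a singleton is open precisely when it belongs to the
  base. For the base of locally closed sets, this turns discreteness, which says that all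
  singletons are open, into the \<open>T\<^sub>D\<close> condition.\<close>

lemma arbitrary_union_of_singleton_iff:
  "(arbitrary union_of P) {x} \<longleftrightarrow> P {x}"
proof
  assume "(arbitrary union_of P) {x}"
  then obtain \<U> where \<U>: "\<And>S. S \<in> \<U> \<Longrightarrow> P S" "\<Union>\<U> = {x}"
    by (auto simp: union_of_def arbitrary_def)
  then obtain S where "S \<in> \<U>" "x \<in> S"
    by blast
  moreover from this have "S = {x}"
    using \<U>(2) by blast
  ultimately show "P {x}"
    using \<U>(1) by blast
qed (rule arbitrary_union_of_inc)

theorem proposition2p5:
  fixes X :: "'a topology"
  shows "T_D_space X \<longleftrightarrow>
    locally_closed_topology X = discrete_topology (topspace X)"
proof -
  have "T_D_space X \<longleftrightarrow>
      (\<forall>x\<in>topspace X. openin (locally_closed_topology X) {x})"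
    by (simp add: T_D_space_def openin_locally_closed_topology arbitrary_union_of_singleton_iff)
  also have "\<dots> \<longleftrightarrow> discrete_topology (topspace X) = locally_closed_topology X"
    by (simp add: discrete_topology_unique)
  finally show ?thesis
    by (simp only: eq_commute)
qed

end
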